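(* Let $d,k\ge1$ be integers, let $\Sigma\in\mathbb{R}^{d\times d}$ be symmetric positive definite, let $\boldsymbol{\mu}_1,\dots,\boldsymbol{\mu}_k\in\mathbb{R}^d$, and let $p^{\mathrm{in}}$ be the density of the equal-weight Gaussian mixture $\frac1k\sum_{j=1}^k\mathcal{N}(\boldsymbol{\mu}_j,\Sigma)$ on $\mathbb{R}^d$. Put $\beta=\sqrt{(2\pi)^d|\Sigma|}$. Then for every threshold $\lambda>0$, \[ g^{\mathrm{ideal}}_{\lambda}=g^{\mathrm{GEM}}_{\log(k\beta\lambda)} \] as functions $\mathbb{R}^d\to\{\mathrm{in},\mathrm{out}\}$.
   Context: $|\Sigma|$ denotes the determinant of $\Sigma$. For a threshold $\lambda$, the ideal classifier $g^{\mathrm{ideal}}_\lambda:\mathbb{R}^d\to\{\mathrm{in},\mathrm{out}\}$ is defined by $g^{\mathrm{ideal}}_\lambda(\mathbf{x})=\mathrm{in}$ if $p^{\mathrm{in}}(\mathbf{x})\ge\lambda$ and $\mathrm{out}$ if $p^{\mathrm{in}}(\mathbf{x})<\lambda$. The GEM score is $\mathrm{GEM}(\mathbf{x})=\log\sum_{j=1}^k\exp\big(-\tfrac12(\mathbf{x}-\boldsymbol{\mu}_j)^{\top}\Sigma^{-1}(\mathbf{x}-\boldsymbol{\mu}_j)\big)$, and $g^{\mathrm{GEM}}_\lambda(\mathbf{x})=\mathrm{in}$ if $\mathrm{GEM}(\mathbf{x})\ge\lambda$ and $\mathrm{out}$ if $\mathrm{GEM}(\mathbf{x})<\lambda$. 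*)

theory Defs
  imports "HOL-Analysis.Analysis"
begin

datatype label = In | Out

definition symmetric_positive_definite :: "real ^ 'd ^ 'd \<Rightarrow> bool" where
  "symmetric_positive_definite S \<longleftrightarrow>
     transpose S = S \<and> (\<forall>x. x \<noteq> 0 \<longrightarrow> x \<bullet> (S *v x) > 0)"

definition multivariate_normal_density ::
    "real ^ 'd \<Rightarrow> real ^ 'd ^ 'd \<Rightarrow> real ^ 'd \<Rightarrow> real" where
  "multivariate_normal_density m S x =
     exp (- (1/2) * ((x - m) \<bullet> (matrix_inv S *v (x - m)))) /
       sqrt ((2 * pi) ^ CARD('d) * det S)"

text \<open>The component means are indexed by \<open>1, \<dots>, k\<close>; values of \<open>\<mu>\<close> at other
  indices are irrelevant.  A density is only determined up to null sets; the one
  used here is the continuous one.\<close>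

definition gaussian_mixture_density ::
    "nat \<Rightarrow> (nat \<Rightarrow> real ^ 'd) \<Rightarrow> real ^ 'd ^ 'd \<Rightarrow> real ^ 'd \<Rightarrow> real" where
  "gaussian_mixture_density k \<mu> S x =
     (1 / real k) * (\<Sum>j = 1..k. multivariate_normal_density (\<mu> j) S x)"

definition GEM :: "nat \<Rightarrow> (nat \<Rightarrow> real ^ 'd) \<Rightarrow> real ^ 'd ^ 'd \<Rightarrow> real ^ 'd \<Rightarrow> real" where
  "GEM k \<mu> S x =
     ln (\<Sum>j = 1..k. exp (- (1/2) * ((x - \<mu> j) \<bullet> (matrix_inv S *v (x - \<mu> j)))))"

definition g_ideal :: "(real ^ 'd \<Rightarrow> real) \<Rightarrow> real \<Rightarrow> real ^ 'd \<Rightarrow> label" where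
  "g_ideal p_in l x = (if p_in x \<ge> l then In else Out)"

definition g_GEM ::
    "nat \<Rightarrow> (nat \<Rightarrow> real ^ 'd) \<Rightarrow> real ^ 'd ^ 'd \<Rightarrow> real \<Rightarrow> real ^ 'd \<Rightarrow> label" where
  "g_GEM k \<mu> S l x = (if GEM k \<mu> S x \<ge> l then In else Out)"

end

theory Submission
  imports Defs
begin

text \<open>All components share one covariance, hence one normalising constant \<beta>, and so
  \<open>p_in x\<close> = exp(GEM(x)) / (k \<beta>). Thresholding the density at \<open>l\<close> is
  thresholding exp(GEM(x)) at k \<beta> \<open>l\<close>, and the logarithm preserves the
  comparison. This needs \<beta> > 0, that is \<open>det S > 0\<close>, which
  \<open>det_pos_if_quadratic_form_pos\<close> supplies.\<close>

lemma det_nonzero_if_quadratic_form_pos: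
  fixes A :: "real ^ 'd ^ 'd"
  assumes "\<And>x. x \<noteq> 0 \<Longrightarrow> x \<bullet> (A *v x) > 0"
  shows "det A \<noteq> 0"
proof -
  have "x = 0" if "A *v x = 0" for x
    using assms[of x] that by force
  then have "invertible A"
    by (simp add: invertible_left_inverse matrix_left_invertible_ker)
  then show ?thesis
    by (simp add: invertible_det_nz)
qed

text \<open>The determinant is continuous and does not vanish on the segment from the
  identity to \<open>A\<close>, so it has the same sign at both ends.\<close>

lemma det_pos_if_quadratic_form_pos:
  fixes A :: "real ^ 'd ^ 'd"
  assumes A: "\<And>x. x \<noteq> 0 \<Longrightarrow> x \<bullet> (A *v x) > 0"
  shows "det A > 0"
proof (rule ccontr)
  define B :: "real \<Rightarrow> real ^ 'd ^ 'd"
    where "B t = (1 - t) *\<^sub>R mat 1 + t *\<^sub>R A" for t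
  assume "\<not> det A > 0"
  then have "det (B 1) \<le> 0" "0 \<le> det (B 0)"
    by (simp_all add: B_def)
  moreover have "continuous_on {0..1} (\<lambda>t. det (B t))"
    unfolding det_def B_def by (simp, intro continuous_intros)
  ultimately obtain t where t: "0 \<le> t" "t \<le> 1" "det (B t) = 0"
    using IVT2'[of "\<lambda>t. det (B t)" 1 0 0] by auto
  \<comment> \<open>Positivity of the form survives convex combinations, so \<open>B t\<close>
    cannot be singular, against the zero just found.\<close>
  have "x \<bullet> (B t *v x) > 0" if "x \<noteq> 0" for x
  proof -
    have "x \<bullet> (B t *v x) = (1 - t) * (x \<bullet> x) + t * (x \<bullet> (A *v x))"
      by (simp add: B_def matrix_vector_mult_add_rdistrib scaleR_matrix_vector_assoc [symmetric]
          inner_add_right)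
    moreover have "x \<bullet> x > 0" "x \<bullet> (A *v x) > 0"
      using that A by simp_all
    \<comment> \<open>For t > 0 the summand from \<open>A\<close> is strictly positive; at t = 0 it
      vanishes and the identity part takes over.\<close>
    ultimately show ?thesis
      using t by (cases "t = 0") (auto intro: add_nonneg_pos)
  qed
  with t det_nonzero_if_quadratic_form_pos show False
    by blast
qed

theorem lemma1:
  fixes k :: nat and \<mu> :: "nat \<Rightarrow> real ^ 'd" and S :: "real ^ 'd ^ 'd"
    and p_in :: "real ^ 'd \<Rightarrow> real" and \<beta> l :: real
  assumes "k \<ge> 1"
    and "symmetric_positive_definite S"
    and "p_in = gaussian_mixture_density k \<mu> S"
    and "\<beta> = sqrt ((2 * pi) ^ CARD('d) * det S)"
    and "l > 0"
  shows "g_ideal p_in l = g_GEM k \<mu> S (ln (real k * \<beta> * l))"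
proof
  fix x
  define E where
    "E = (\<Sum>j = 1..k. exp (- (1/2) * ((x - \<mu> j) \<bullet> (matrix_inv S *v (x - \<mu> j)))))"
  have "det S > 0"
    using assms(2) det_pos_if_quadratic_form_pos
    by (auto simp: symmetric_positive_definite_def)
  then have "\<beta> > 0"
    using assms(4) by simp
  \<comment> \<open>\<open>k \<ge> 1\<close> makes the sum nonempty.\<close>
  have "E > 0"
    unfolding E_def using assms(1) by (intro sum_pos) auto
  have "p_in x = E / (real k * \<beta>)"
    by (simp add: assms(3,4) gaussian_mixture_density_def multivariate_normal_density_def
        E_def sum_divide_distrib [symmetric])
  then have "l \<le> p_in x \<longleftrightarrow> real k * \<beta> * l \<le> E"
    using assms(1) \<open>\<beta> > 0\<close> by (simp add: pos_le_divide_eq mult.commute)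
  \<comment> \<open>Comparing logarithms is faithful because both arguments are positive;
    \<open>l > 0\<close> enters here.\<close>
  also have "\<dots> \<longleftrightarrow> ln (real k * \<beta> * l) \<le> GEM k \<mu> S x"
    using assms(1,5) \<open>\<beta> > 0\<close> \<open>E > 0\<close> by (simp add: GEM_def E_def)
  finally show "g_ideal p_in l x = g_GEM k \<mu> S (ln (real k * \<beta> * l)) x"
    by (simp add: g_ideal_def g_GEM_def)
qed

end
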